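(* The epigraph of the penalty function, $E_P=\left\{(b,g) \in \mathbb{R}^2_+ : b^{1.5} \leq g \right\}$, is conic quadratic representable.
   Context: $\mathbb{R}_+$ denotes the nonnegative reals. A set $X \subseteq \mathbb{R}^n$ is conic quadratic representable if there exist an integer $m\ge 0$ and finitely many conic quadratic (second-order cone) inequalities $\|A_k (x,w) + p_k\|_2 \leq q_k^{\top}(x,w) + r_k$, $k=1,\dots,K$, in variables $x\in\mathbb{R}^n$ and $w\in\mathbb{R}^m$ (with real matrices $A_k$, real vectors $p_k,q_k$ and real numbers $r_k$; linear inequalities are included as the case where the left side is $0$), such that $x \in X$ if and only if there is $w \in \mathbb{R}^m$ for which $(x,w)$ satisfies all $K$ inequalities. *)

theory Defs
  imports Complex_Main "Jordan_Normal_Form.Matrix"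
begin

definition l2_norm :: "real vec \<Rightarrow> real" where
  "l2_norm v = sqrt (v \<bullet> v)"

definition conic_quadratic_ineq ::
  "real mat \<Rightarrow> real vec \<Rightarrow> real vec \<Rightarrow> real \<Rightarrow> real vec \<Rightarrow> bool" where
  "conic_quadratic_ineq A p q r y \<longleftrightarrow> l2_norm (A *\<^sub>v y + p) \<le> q \<bullet> y + r"

(* Each inequality k has its own number of rows d k. A linear inequality is the case d k = 0
   (or A k and p k zero), where the left-hand side vanishes. *)
definition conic_quadratic_representable :: "nat \<Rightarrow> real vec set \<Rightarrow> bool" where
  "conic_quadratic_representable n X \<longleftrightarrow>
     X \<subseteq> carrier_vec n \<and>
     (\<exists>(m::nat) (K::nat) (d :: nat \<Rightarrow> nat) (A :: nat \<Rightarrow> real mat) (p :: nat \<Rightarrow> real vec)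
        (q :: nat \<Rightarrow> real vec) (r :: nat \<Rightarrow> real).
        (\<forall>k\<in>{1..K}. A k \<in> carrier_mat (d k) (n + m) \<and> p k \<in> carrier_vec (d k) \<and>
                    q k \<in> carrier_vec (n + m)) \<and>
        (\<forall>x\<in>carrier_vec n. x \<in> X \<longleftrightarrow>
           (\<exists>w\<in>carrier_vec m. \<forall>k\<in>{1..K}.
              conic_quadratic_ineq (A k) (p k) (q k) (r k) (x @\<^sub>v w))))"

definition penalty_epigraph :: "real vec set" where
  "penalty_epigraph =
     {vec_of_list [b, g] | b g :: real. b \<ge> 0 \<and> g \<ge> 0 \<and> b powr 1.5 \<le> g}"

end

theory Submission
  imports Defs
begin

text \<open>
  For nonnegative \<open>b\<close> the inequality \<open>b\<^sup>3\<^sup>/\<^sup>2 \<le> g\<close> is split by one auxiliary variable \<open>w\<close>, which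
  stands for a lower bound of \<open>\<surd>b\<close>, into two inequalities of the form ``square at most a product'':
  \<open>w\<^sup>2 \<le> b \<cdot> 1\<close> and \<open>b\<^sup>2 \<le> w \<cdot> g\<close>.  From left to right one takes \<open>w = \<surd>b\<close>; from right to left,
  \<open>b\<^sup>2 \<le> w \<cdot> g \<le> \<surd>b \<cdot> g\<close>, and for \<open>b > 0\<close> a factor \<open>\<surd>b\<close> cancels
  (\<open>powr_three_halves_le_iff\<close>).

  An inequality \<open>s\<^sup>2 \<le> u v\<close> between nonnegative affine forms \<open>u\<close>, \<open>v\<close> and an affine form \<open>s\<close>
  describes a rotated second-order cone.  Because \<open>4 u v = (u + v)\<^sup>2 - (u - v)\<^sup>2\<close>, it is the single
  conic quadratic inequality \<open>\<parallel>(2 s, u - v)\<parallel> \<le> u + v\<close>, which moreover forces \<open>u, v \<ge> 0\<close>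
  (\<open>conic_quadratic_ineq_rotated_cone\<close>).  The two inequalities thus already contain all sign
  conditions, and the representation has one auxiliary variable and two cones.
\<close>

text \<open>
  The signs come for free: \<open>0 \<le> s\<^sup>2 \<le> u v\<close> keeps \<open>u\<close> and \<open>v\<close> from having opposite signs, and
  the norm bound makes their sum nonnegative.
\<close>

lemma sqrt_le_add_iff_square_le_mult:
  fixes s u v :: real
  shows "sqrt ((2 * s)\<^sup>2 + (u - v)\<^sup>2) \<le> u + v \<longleftrightarrow> s\<^sup>2 \<le> u * v \<and> 0 \<le> u \<and> 0 \<le> v"
proof -
  have polarization: "(2 * s)\<^sup>2 + (u - v)\<^sup>2 \<le> (u + v)\<^sup>2 \<longleftrightarrow> s\<^sup>2 \<le> u * v"
    by (simp add: power2_eq_square algebra_simps)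
  have sqrt_le: "sqrt ((2 * s)\<^sup>2 + (u - v)\<^sup>2) \<le> u + v \<longleftrightarrow>
      0 \<le> u + v \<and> (2 * s)\<^sup>2 + (u - v)\<^sup>2 \<le> (u + v)\<^sup>2"
  proof
    assume le: "sqrt ((2 * s)\<^sup>2 + (u - v)\<^sup>2) \<le> u + v"
    have "0 \<le> sqrt ((2 * s)\<^sup>2 + (u - v)\<^sup>2)"
      by simp
    then show "0 \<le> u + v \<and> (2 * s)\<^sup>2 + (u - v)\<^sup>2 \<le> (u + v)\<^sup>2"
      using le sqrt_le_D[OF le] by linarith
  next
    assume "0 \<le> u + v \<and> (2 * s)\<^sup>2 + (u - v)\<^sup>2 \<le> (u + v)\<^sup>2"
    then show "sqrt ((2 * s)\<^sup>2 + (u - v)\<^sup>2) \<le> u + v"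
      by (intro real_le_lsqrt) auto
  qed
  have "0 \<le> u \<and> 0 \<le> v" if "0 \<le> u + v" "s\<^sup>2 \<le> u * v"
  proof -
    have "0 \<le> u * v"
      using that(2) zero_le_power2[of s] by linarith
    with that(1) show ?thesis
      by (auto simp: zero_le_mult_iff)
  qed
  then show ?thesis
    using sqrt_le polarization by auto
qed

text \<open>
  The rotated second-order cone as one conic quadratic inequality in a vector \<open>y\<close>, for the affine
  forms \<open>s = a \<bullet> y + \<alpha>\<close>, \<open>u = c \<bullet> y + \<gamma>\<close> and \<open>v = e \<bullet> y + \<delta>\<close>.
\<close>

lemma conic_quadratic_ineq_rotated_cone:
  fixes a c e y :: "real vec"
  assumes [simp]: "a \<in> carrier_vec n" "c \<in> carrier_vec n" "e \<in> carrier_vec n" "y \<in> carrier_vec n"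
  shows "conic_quadratic_ineq (mat_of_rows n [2 \<cdot>\<^sub>v a, c - e]) (vec_of_list [2 * \<alpha>, \<gamma> - \<delta>])
           (c + e) (\<gamma> + \<delta>) y \<longleftrightarrow>
         (a \<bullet> y + \<alpha>)\<^sup>2 \<le> (c \<bullet> y + \<gamma>) * (e \<bullet> y + \<delta>) \<and> 0 \<le> c \<bullet> y + \<gamma> \<and> 0 \<le> e \<bullet> y + \<delta>"
    (is "conic_quadratic_ineq ?A ?p _ _ _ \<longleftrightarrow> _")
proof -
  have affine: "?A *\<^sub>v y + ?p =
      vec_of_list [2 * (a \<bullet> y + \<alpha>), (c \<bullet> y + \<gamma>) - (e \<bullet> y + \<delta>)]" (is "?l = ?r")
  proof (rule eq_vecI)
    fix i assume "i < dim_vec ?r"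
    then consider "i = 0" | "i = 1"
      by fastforce
    then show "?l $ i = ?r $ i"
      by cases (simp_all add: minus_scalar_prod_distrib[of _ n] algebra_simps
          smult_scalar_prod_distrib[of _ n])
  qed simp
  have norm: "l2_norm (vec_of_list [s, t]) = sqrt (s\<^sup>2 + t\<^sup>2)" for s t
    by (simp add: l2_norm_def scalar_prod_def power2_eq_square)
  have rhs: "(c + e) \<bullet> y + (\<gamma> + \<delta>) = (c \<bullet> y + \<gamma>) + (e \<bullet> y + \<delta>)"
    by (simp add: add_scalar_prod_distrib[of _ n])
  show ?thesis
    unfolding conic_quadratic_ineq_def affine norm rhs sqrt_le_add_iff_square_le_mult ..
qed

lemma powr_three_halves_le_iff:
  fixes b g :: real
  shows "0 \<le> b \<and> 0 \<le> g \<and> b powr 1.5 \<le> g \<longleftrightarrow>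
         (\<exists>w. (b\<^sup>2 \<le> w * g \<and> 0 \<le> w \<and> 0 \<le> g) \<and> w\<^sup>2 \<le> b)"
proof -
  have powr_eq: "b powr 1.5 = b * sqrt b" if "0 \<le> b"
  proof -
    have "b powr 1.5 = b powr (1 + 1/2)"
      by simp
    also have "\<dots> = b * sqrt b"
      using that by (simp only: powr_add powr_half_sqrt powr_one)
    finally show ?thesis .
  qed
  show ?thesis
  proof
    assume bg: "0 \<le> b \<and> 0 \<le> g \<and> b powr 1.5 \<le> g"
    have "b\<^sup>2 = sqrt b * (b * sqrt b)"
      using bg by (simp add: power2_eq_square)
    also have "\<dots> \<le> sqrt b * g"
      using bg powr_eq by (intro mult_left_mono) auto
    finally show "\<exists>w. (b\<^sup>2 \<le> w * g \<and> 0 \<le> w \<and> 0 \<le> g) \<and> w\<^sup>2 \<le> b"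
      using bg by (intro exI[of _ "sqrt b"]) auto
  next
    assume "\<exists>w. (b\<^sup>2 \<le> w * g \<and> 0 \<le> w \<and> 0 \<le> g) \<and> w\<^sup>2 \<le> b"
    then obtain w where w: "b\<^sup>2 \<le> w * g" "0 \<le> w" "0 \<le> g" "w\<^sup>2 \<le> b"
      by blast
    have "0 \<le> b"
      using w(4) zero_le_power2[of w] by linarith
    have "w \<le> sqrt b"
      using w(4) by (rule real_le_rsqrt)
    have "b * sqrt b \<le> g"
    proof (cases "b = 0")
      case True
      then show ?thesis
        using w(3) by simp
    next
      case False
      have "sqrt b * (b * sqrt b) = b\<^sup>2"
        using \<open>0 \<le> b\<close> by (simp add: power2_eq_square)
      also have "\<dots> \<le> sqrt b * g"
        using w(1) mult_right_mono[OF \<open>w \<le> sqrt b\<close> w(3)] by linarith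
      finally show ?thesis
        using False \<open>0 \<le> b\<close> by (simp add: mult_le_cancel_left_pos)
    qed
    then show "0 \<le> b \<and> 0 \<le> g \<and> b powr 1.5 \<le> g"
      using \<open>0 \<le> b\<close> w(3) powr_eq by simp
  qed
qed

theorem proposition2:
  shows "conic_quadratic_representable 2 penalty_epigraph"
proof -
  \<comment> \<open>The coordinates of \<open>y = (b, g, w)\<close> as linear forms.\<close>
  define eb eg ew :: "real vec" where
    "eb = unit_vec 3 0" and "eg = unit_vec 3 1" and "ew = unit_vec 3 2"
  note e_defs = eb_def eg_def ew_def
  have carrier: "eb \<in> carrier_vec 3" "eg \<in> carrier_vec 3" "ew \<in> carrier_vec 3"
    by (simp_all add: e_defs)
  \<comment> \<open>Index \<open>1\<close> is the cone \<open>b\<^sup>2 \<le> w g\<close>, index \<open>2\<close> is the cone \<open>w\<^sup>2 \<le> b \<cdot> 1\<close>, where the factor \<open>1\<close>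
    is the zero form with constant term \<open>1\<close>.\<close>
  define A where "A k = (if k = 1 then mat_of_rows 3 [2 \<cdot>\<^sub>v eb, ew - eg]
    else mat_of_rows 3 [2 \<cdot>\<^sub>v ew, eb - 0\<^sub>v 3])" for k :: nat
  define p :: "nat \<Rightarrow> real vec" where
    "p k = (if k = 1 then vec_of_list [2 * 0, 0 - 0] else vec_of_list [2 * 0, 0 - 1])" for k
  define q where "q k = (if k = 1 then ew + eg else eb + 0\<^sub>v 3)" for k :: nat
  define r :: "nat \<Rightarrow> real" where "r k = (if k = 1 then 0 + 0 else 0 + 1)" for k
  have cones: "(\<forall>k\<in>{1..2}. conic_quadratic_ineq (A k) (p k) (q k) (r k)
        (vec_of_list [b, g] @\<^sub>v vec_of_list [w])) \<longleftrightarrow>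
      (b\<^sup>2 \<le> w * g \<and> 0 \<le> w \<and> 0 \<le> g) \<and> w\<^sup>2 \<le> b" for b g w
  proof -
    define y where "y = vec_of_list [b, g] @\<^sub>v vec_of_list [w]"
    have y: "y \<in> carrier_vec 3"
      by (rule carrier_vecI) (simp add: y_def)
    have coords: "eb \<bullet> y = b" "eg \<bullet> y = g" "ew \<bullet> y = w"
      using y by (simp_all add: e_defs y_def numeral_2_eq_2)
    have "conic_quadratic_ineq (A 1) (p 1) (q 1) (r 1) y \<longleftrightarrow> b\<^sup>2 \<le> w * g \<and> 0 \<le> w \<and> 0 \<le> g"
      using conic_quadratic_ineq_rotated_cone[OF carrier(1,3,2) y, of 0 0 0]
      by (simp add: A_def p_def q_def r_def coords)
    moreover have "conic_quadratic_ineq (A 2) (p 2) (q 2) (r 2) y \<longleftrightarrow> w\<^sup>2 \<le> b \<and> 0 \<le> b"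
      using conic_quadratic_ineq_rotated_cone[OF carrier(3,1) zero_carrier_vec y, of 0 0 1] y
      by (simp add: A_def p_def q_def r_def coords)
    moreover have "0 \<le> b" if "w\<^sup>2 \<le> b"
      using that zero_le_power2[of w] by linarith
    moreover have "{1..2} = {1, 2 :: nat}"
      by auto
    ultimately show ?thesis
      unfolding y_def[symmetric] by auto
  qed
  have vec1: "v = vec_of_list [v $ 0]" if "v \<in> carrier_vec 1" for v :: "real vec"
    using that by (intro eq_vecI) auto
  have vec2: "v = vec_of_list [v $ 0, v $ 1]" if "v \<in> carrier_vec 2" for v :: "real vec"
    using that by (intro eq_vecI) (auto simp: less_Suc_eq)
  have epigraph: "vec_of_list [b, g] \<in> penalty_epigraph \<longleftrightarrow> 0 \<le> b \<and> 0 \<le> g \<and> b powr 1.5 \<le> g" for b g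
  proof -
    have "vec_of_list [b, g] = vec_of_list [b', g'] \<longleftrightarrow> b = b' \<and> g = g'" for b' g' :: real
      by (metis list_vec list.inject)
    then show ?thesis
      by (auto simp: penalty_epigraph_def)
  qed
  have representation: "x \<in> penalty_epigraph \<longleftrightarrow> (\<exists>w\<in>carrier_vec 1. \<forall>k\<in>{1..2}.
      conic_quadratic_ineq (A k) (p k) (q k) (r k) (x @\<^sub>v w))" (is "_ \<longleftrightarrow> (\<exists>w\<in>_. ?C w)")
    if x: "x \<in> carrier_vec 2" for x
  proof -
    have "vec_of_list [t] \<in> carrier_vec 1" for t :: real
      by (rule carrier_vecI) simp
    then have "(\<exists>w\<in>carrier_vec 1. ?C w) \<longleftrightarrow> (\<exists>t. ?C (vec_of_list [t]))"
      using vec1 by metis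
    also have "\<dots> \<longleftrightarrow> x \<in> penalty_epigraph"
      using cones[of "x $ 0" "x $ 1"] epigraph[of "x $ 0" "x $ 1"]
        powr_three_halves_le_iff[of "x $ 0" "x $ 1"]
      unfolding vec2[OF x, symmetric] by simp
    finally show ?thesis ..
  qed
  have dims: "\<forall>k\<in>{1..2}. A k \<in> carrier_mat 2 (2 + 1) \<and> p k \<in> carrier_vec 2 \<and>
      q k \<in> carrier_vec (2 + 1)"
    using carrier by (auto simp: A_def p_def q_def intro!: carrier_vecI)
  have "penalty_epigraph \<subseteq> carrier_vec 2"
    by (auto simp: penalty_epigraph_def intro!: carrier_vecI)
  with dims representation show ?thesis
    unfolding conic_quadratic_representable_def
    by (intro conjI exI[of _ 1] exI[of _ 2] exI[of _ "\<lambda>_. 2"] exI[of _ A] exI[of _ p]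
        exI[of _ q] exI[of _ r]) auto
qed

end
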